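(* Let $d=1$ and let $n>6$ be an integer. Define $\bar P,\tilde P\in\mathbb{R}^{n\times 1}$ by $\bar p_1=2$, $\bar p_2=0$, $\bar p_3=\cdots=\bar p_n=1$, and $\tilde p_1=\tilde p_2=0$, $\tilde p_3=\cdots=\tilde p_n=1$. Let $\bar D=\mathcal D(\bar P)$ and $f(P)=\frac12\|\mathcal K(PP^T)-\bar D\|_F^2$ for $P\in\mathbb{R}^{n\times 1}$. Then $\tilde P$ is a local nonglobal minimizer of $f$, i.e. $\tilde P$ is a local minimizer of $f$ over $\mathbb{R}^{n\times 1}$ that is not a global minimizer of $f$.
   Context: $e$ is the all-ones vector in $\mathbb{R}^n$, $\|\cdot\|_F$ is the Frobenius norm. For a symmetric $n\times n$ matrix $G$, $\mathcal K(G)=\operatorname{diag}(G)e^T+e\operatorname{diag}(G)^T-2G$, where $\operatorname{diag}(G)$ is the vector of diagonal entries. For $P\in\mathbb{R}^{n\times 1}$ with entries $p_1,\dots,p_n$, $\mathcal D(P)=\mathcal K(PP^T)=((p_i-p_j)^2)_{ij}$. *)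

theory Defs
  imports "HOL-Analysis.Analysis"
begin

definition diag_vec :: "real^'n^'n \<Rightarrow> real^'n" where
  "diag_vec G = (\<chi> i. G $ i $ i)"

text \<open>
  \<open>K_map G\<close> is \<open>diag(G) e\<^sup>T + e diag(G)\<^sup>T - 2 G\<close>; the vector \<open>1 :: real^'n\<close> is the
  all-ones vector \<open>e\<close>. The intermediate column and row matrices have the one-element index
  type \<open>1\<close>.
\<close>
definition K_map :: "real^'n^'n \<Rightarrow> real^'n^'n" where
  "K_map G = (columnvector (diag_vec G) :: real^1^'n) ** (rowvector 1 :: real^'n^1)
           + (columnvector 1 :: real^1^'n) ** (rowvector (diag_vec G) :: real^'n^1)
           - 2 *\<^sub>R G"

definition D_map :: "real^'d^'n \<Rightarrow> real^'n^'n" where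
  "D_map P = K_map (P ** transpose P)"

lemma D_map_component:
  fixes P :: "real^1^'n"
  shows "D_map P $ i $ j = (P $ i $ 1 - P $ j $ 1)\<^sup>2"
  by (simp add: D_map_def K_map_def diag_vec_def columnvector_def rowvector_def
      matrix_matrix_mult_def transpose_def UNIV_1 power2_eq_square algebra_simps)

text \<open>The library norm on matrices of type \<open>real^'n^'m\<close> is the Frobenius norm.\<close>
lemma norm_matrix_eq_frobenius:
  fixes A :: "real^'n^'m"
  shows "norm A = sqrt (\<Sum>i\<in>UNIV. \<Sum>j\<in>UNIV. (A $ i $ j)\<^sup>2)"
  by (simp add: norm_vec_def L2_set_def sum_nonneg)

definition objective :: "real^'n^'n \<Rightarrow> real^'d^'n \<Rightarrow> real" where
  "objective Dbar P = 1/2 * (norm (K_map (P ** transpose P) - Dbar))\<^sup>2"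

definition local_minimizer :: "('a::metric_space \<Rightarrow> real) \<Rightarrow> 'a \<Rightarrow> bool" where
  "local_minimizer f x \<longleftrightarrow> (\<exists>\<epsilon>>0. \<forall>y. dist y x < \<epsilon> \<longrightarrow> f x \<le> f y)"

definition global_minimizer :: "('a \<Rightarrow> real) \<Rightarrow> 'a \<Rightarrow> bool" where
  "global_minimizer f x \<longleftrightarrow> (\<forall>y. f x \<le> f y)"

text \<open>
  Matrices in \<open>R\<^sup>n\<^sup>\<times>\<^sup>1\<close> whose rows are indexed by a type with \<open>n\<close> elements; \<open>i1\<close> and \<open>i2\<close>
  are the (distinct) indices called 1 and 2 in the numbering of the rows.
\<close>
definition P_bar :: "'n \<Rightarrow> 'n \<Rightarrow> real^1^'n" where
  "P_bar i1 i2 = (\<chi> i k. if i = i1 then 2 else if i = i2 then 0 else 1)"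

definition P_tilde :: "'n \<Rightarrow> 'n \<Rightarrow> real^1^'n" where
  "P_tilde i1 i2 = (\<chi> i k. if i = i1 \<or> i = i2 then 0 else 1)"

end

theory Submission
  imports Defs
begin

text \<open>
  Write \<open>a, b\<close> for the first two entries of a point near \<open>P_tilde\<close> and \<open>p k\<close> for the
  others. At \<open>P_tilde\<close> only the pair of the first two rows is misplaced: its squared distance is
  \<open>0\<close> instead of \<open>4\<close>, so the objective is \<open>16\<close>, whereas it vanishes at \<open>P_bar\<close>.

  Pulling the first two rows apart gains at most a quadratic amount, since
  \<open>((a - b)\<^sup>2 - 4)\<^sup>2 \<ge> 16 - 8 (a - b)\<^sup>2\<close>. Every other row \<open>k\<close> resists: it wants distance \<open>1\<close> from
  both, and with the defects \<open>s = p k - a - 1\<close>, \<open>t = p k - b - 1\<close> its two terms are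
  \<open>s\<^sup>2 (2 + s)\<^sup>2 + t\<^sup>2 (2 + t)\<^sup>2\<close>, which is about \<open>4 (s\<^sup>2 + t\<^sup>2) \<ge> 2 (t - s)\<^sup>2 = 2 (a - b)\<^sup>2\<close>.
  There are \<open>n - 2\<close> such rows, and \<open>2 (n - 2) > 8\<close> exactly when \<open>n > 6\<close>; the strict inequality
  leaves room for replacing the factors \<open>(2 + s)\<^sup>2\<close> and \<open>(2 + t)\<^sup>2\<close> by \<open>16/5 < 4\<close>, which is valid
  in a neighbourhood and still gives \<open>8/5 (n - 2) \<ge> 8\<close>. The terms among the other rows are
  nonnegative and can be dropped.
\<close>

lemma objective_D_map_eq_sum:
  fixes P Q :: "real^1^'n"
  shows "objective (D_map Q) P =
    1/2 * (\<Sum>i\<in>UNIV. \<Sum>j\<in>UNIV. ((P $ i $ 1 - P $ j $ 1)\<^sup>2 - (Q $ i $ 1 - Q $ j $ 1)\<^sup>2)\<^sup>2)"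
proof -
  have "objective (D_map Q) P = 1/2 * (norm (D_map P - D_map Q))\<^sup>2"
    by (simp add: objective_def D_map_def)
  then show ?thesis
    by (simp add: norm_matrix_eq_frobenius sum_nonneg D_map_component)
qed

text \<open>
  The factor \<open>2\<close> counts each pair in both orders; the diagonal terms and the pairs disjoint from
  \<open>{a, b}\<close> are discarded as nonnegative.
\<close>
lemma double_sum_ge_two_rows:
  fixes g :: "'n::finite \<Rightarrow> 'n \<Rightarrow> real"
  assumes nonneg: "\<And>i j. g i j \<ge> 0" and sym: "\<And>i j. g i j = g j i" and "a \<noteq> b"
  shows "(\<Sum>i\<in>UNIV. \<Sum>j\<in>UNIV. g i j) \<ge> 2 * (g a b + (\<Sum>k\<in>UNIV - {a, b}. g a k + g b k))"
proof -
  let ?S = "UNIV - {a, b}"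
  have split: "sum h UNIV = h a + h b + sum h ?S" for h :: "'n \<Rightarrow> real"
    using \<open>a \<noteq> b\<close> sum.subset_diff[of "{a, b}" UNIV h] by simp
  have rows: "sum (g a) UNIV \<ge> g a b + sum (g a) ?S" "sum (g b) UNIV \<ge> g a b + sum (g b) ?S"
    using split[of "g a"] split[of "g b"] nonneg[of a a] nonneg[of b b] sym[of a b] by simp_all
  have "(\<Sum>k\<in>?S. sum (g k) UNIV) \<ge> (\<Sum>k\<in>?S. g a k + g b k)"
  proof (rule sum_mono)
    fix k
    show "g a k + g b k \<le> sum (g k) UNIV"
      using split[of "g k"] sum_nonneg[of ?S "g k"] nonneg sym[of k] by simp
  qed
  then show ?thesis
    using split[of "\<lambda>i. sum (g i) UNIV"] rows by (simp add: sum.distrib)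
qed

text \<open>
  One of the other rows, at signed distances \<open>x\<close> and \<open>y\<close> from the first two, near \<open>1\<close>:
  in \<open>x\<^sup>2 - 1 = (x - 1) (x + 1)\<close> the second factor satisfies \<open>(x + 1)\<^sup>2 \<ge> (9/5)\<^sup>2 > 16/5\<close>, and the
  triangle inequality \<open>2 ((x - 1)\<^sup>2 + (y - 1)\<^sup>2) \<ge> (x - y)\<^sup>2\<close> eliminates the position of the row.
\<close>
lemma unit_distance_defects_ge:
  fixes x y :: real
  assumes "x \<ge> 4/5" "y \<ge> 4/5"
  shows "(x\<^sup>2 - 1)\<^sup>2 + (y\<^sup>2 - 1)\<^sup>2 \<ge> 8/5 * (x - y)\<^sup>2"
proof -
  have factor: "(z\<^sup>2 - 1)\<^sup>2 \<ge> 16/5 * (z - 1)\<^sup>2" if "z \<ge> 4/5" for z :: real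
  proof -
    have "(9/5)\<^sup>2 \<le> (z + 1)\<^sup>2"
      using that by (intro power_mono) auto
    then have "16/5 \<le> (z + 1)\<^sup>2"
      by (simp add: power2_eq_square)
    then have "16/5 * (z - 1)\<^sup>2 \<le> (z + 1)\<^sup>2 * (z - 1)\<^sup>2"
      by (intro mult_right_mono) auto
    also have "\<dots> = (z\<^sup>2 - 1)\<^sup>2"
      by (simp add: power2_eq_square algebra_simps)
    finally show ?thesis .
  qed
  have "2 * ((x - 1)\<^sup>2 + (y - 1)\<^sup>2) = (x - y)\<^sup>2 + (x + y - 2)\<^sup>2"
    by (simp add: power2_eq_square algebra_simps)
  then show ?thesis
    using factor[OF assms(1)] factor[OF assms(2)] zero_le_power2[of "x + y - 2"] by argo
qed

lemma objective_P_tilde: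
  fixes i1 i2 :: "'n::finite"
  assumes "i1 \<noteq> i2"
  shows "objective (D_map (P_bar i1 i2)) (P_tilde i1 i2) = 16"
proof -
  have "((P_tilde i1 i2 $ i $ 1 - P_tilde i1 i2 $ j $ 1)\<^sup>2
       - (P_bar i1 i2 $ i $ 1 - P_bar i1 i2 $ j $ 1)\<^sup>2)\<^sup>2
     = (if i = i1 then if j = i2 then 16 else 0 else 0)
     + (if i = i2 then if j = i1 then 16 else 0 else 0)" for i j
    using assms by (auto simp: P_tilde_def P_bar_def)
  moreover have "(\<Sum>j\<in>UNIV. if i = a then if j = b then 16 else 0 else 0) = (if i = a then 16 else 0 :: real)"
    for i a b :: 'n
    by simp
  ultimately show ?thesis
    by (simp add: objective_D_map_eq_sum sum.distrib)
qed

lemma local_minimizer_P_tilde: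
  fixes i1 i2 :: "'n::finite"
  assumes n: "CARD('n) > 6" and "i1 \<noteq> i2"
  shows "local_minimizer (objective (D_map (P_bar i1 i2))) (P_tilde i1 i2)"
  unfolding local_minimizer_def
  \<comment> \<open>Two entries moved by less than \<open>1/10\<close> keep a difference of \<open>1\<close> above \<open>4/5\<close>.\<close>
proof (intro exI[of _ "1/10"] conjI allI impI)
  fix P :: "real^1^'n"
  assume "dist P (P_tilde i1 i2) < 1/10"
  then have near: "\<bar>P $ i $ 1 - P_tilde i1 i2 $ i $ 1\<bar> < 1/10" for i
    using dist_vec_nth_le[of "P $ i" 1 "P_tilde i1 i2 $ i"]
      dist_vec_nth_le[of P i "P_tilde i1 i2"]
    by (simp add: dist_real_def)
  define p where "p i = P $ i $ 1" for i
  define q where "q i = P_bar i1 i2 $ i $ 1" for i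
  define g where "g i j = ((p i - p j)\<^sup>2 - (q i - q j)\<^sup>2)\<^sup>2" for i j
  define S where "S = UNIV - {i1, i2}"
  define h where "h = (p i1 - p i2)\<^sup>2"
  have "card S \<ge> 5"
    using n \<open>i1 \<noteq> i2\<close> by (simp add: S_def card_Diff_subset)
  then have "8 * h \<le> of_nat (card S) * (8/5 * h)"
    using mult_right_mono[of 5 "real (card S)" h] by (simp add: h_def)
  also have "\<dots> \<le> (\<Sum>k\<in>S. g i1 k + g i2 k)"
  proof (rule sum_bounded_below)
    fix k assume "k \<in> S"
    then have k: "k \<noteq> i1" "k \<noteq> i2"
      by (auto simp: S_def)
    have "\<bar>p k - 1\<bar> < 1/10" "\<bar>p i1\<bar> < 1/10" "\<bar>p i2\<bar> < 1/10"
      using near[of k] near[of i1] near[of i2] k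
      by (simp_all add: P_tilde_def p_def)
    then have "p k - p i1 \<ge> 4/5" "p k - p i2 \<ge> 4/5"
      by linarith+
    from unit_distance_defects_ge[OF this]
    show "8/5 * h \<le> g i1 k + g i2 k"
      using k \<open>i1 \<noteq> i2\<close>
      by (simp add: g_def h_def q_def P_bar_def power2_commute[of "p i1" "p k"]
          power2_commute[of "p i2" "p k"] power2_commute[of "p i1" "p i2"])
  qed
  finally have others: "8 * h \<le> (\<Sum>k\<in>S. g i1 k + g i2 k)" .
  have "g i1 i2 = 16 - 8 * h + h\<^sup>2"
    using \<open>i1 \<noteq> i2\<close>
    by (simp add: g_def h_def q_def P_bar_def power2_diff)
  then have pair: "g i1 i2 \<ge> 16 - 8 * h"
    by simp
  have "2 * (g i1 i2 + (\<Sum>k\<in>S. g i1 k + g i2 k)) \<le> (\<Sum>i\<in>UNIV. \<Sum>j\<in>UNIV. g i j)"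
    unfolding S_def
    by (rule double_sum_ge_two_rows) (simp_all add: g_def power2_commute \<open>i1 \<noteq> i2\<close>)
  also have "\<dots> = 2 * objective (D_map (P_bar i1 i2)) P"
    by (simp add: objective_D_map_eq_sum g_def p_def q_def)
  finally show "objective (D_map (P_bar i1 i2)) (P_tilde i1 i2) \<le> objective (D_map (P_bar i1 i2)) P"
    using others pair by (simp add: objective_P_tilde \<open>i1 \<noteq> i2\<close>)
qed simp

theorem mainTheorem2:
  fixes i1 i2 :: "'n::finite" and f :: "real^1^'n \<Rightarrow> real"
  assumes "CARD('n) > 6"
    and "i1 \<noteq> i2"
    and "f = objective (D_map (P_bar i1 i2))"
  shows "local_minimizer f (P_tilde i1 i2) \<and> \<not> global_minimizer f (P_tilde i1 i2)"
proof
  show "local_minimizer f (P_tilde i1 i2)"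
    using local_minimizer_P_tilde assms by blast
  have "f (P_bar i1 i2) = 0"
    by (simp add: assms(3) objective_D_map_eq_sum)
  moreover have "f (P_tilde i1 i2) = 16"
    using assms by (simp add: objective_P_tilde)
  ultimately show "\<not> global_minimizer f (P_tilde i1 i2)"
    by (auto simp: global_minimizer_def not_le intro!: exI[of _ "P_bar i1 i2"])
qed

end
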